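(* Let $H$ be a connected graph, let $s\ge 3$ be an integer, and let $h=\lfloor s/2\rfloor$. Then $$\operatorname{gp}(C_s\boxtimes H)\le \left\lfloor\frac{2s\,\operatorname{gp}(H)}{h+1}\right\rfloor.$$
   Context: All graphs are finite, simple and connected. $d_G(u,v)$ is the usual shortest-path distance in $G$. A set $S\subseteq V(G)$ is a general position set of $G$ if no vertex of $S$ lies on a shortest path between two other vertices of $S$; equivalently, $d_G(u,v)\ne d_G(u,w)+d_G(w,v)$ for all pairwise distinct $u,v,w\in S$. The general position number $\operatorname{gp}(G)$ is the maximum cardinality of a general position set of $G$. The strong product $G\boxtimes H$ has vertex set $V(G)\times V(H)$; distinct vertices $(u_x,u_y)$ and $(v_x,v_y)$ are adjacent if and only if ($u_x=v_x$ and $u_yv_y\in E(H)$), or ($u_y=v_y$ and $u_xv_x\in E(G)$), or ($u_xv_x\in E(G)$ and $u_yv_y\in E(H)$). $C_s$ is the cycle on $s$ vertices. *)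

theory Defs
  imports "Graph_Theory.Graph_Theory"
begin

text \<open>
  Finite simple graphs are the loop-free symmetric digraphs of \<^locale>\<open>pair_graph\<close>, an
  edge \<open>uv\<close> being the two arcs \<open>(u,v)\<close> and \<open>(v,u)\<close>.
\<close>

text \<open>Distance: the library's shortest-path value with every arc of weight 1 (so the cost of a
  walk is its length). It is \<open>\<infinity>\<close> between different components.\<close>

definition gdist :: "'a pair_pre_digraph \<Rightarrow> 'a \<Rightarrow> 'a \<Rightarrow> ereal" where
  "gdist G u v = wf_digraph.\<mu> (with_proj G) (\<lambda>_. 1) u v"

definition general_position_set :: "'a pair_pre_digraph \<Rightarrow> 'a set \<Rightarrow> bool" where
  "general_position_set G S \<longleftrightarrow> S \<subseteq> pverts G \<and>
     (\<forall>u\<in>S. \<forall>v\<in>S. \<forall>w\<in>S. u \<noteq> v \<longrightarrow> u \<noteq> w \<longrightarrow> v \<noteq> w \<longrightarrow>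
        gdist G u v \<noteq> gdist G u w + gdist G w v)"

definition gp :: "'a pair_pre_digraph \<Rightarrow> nat" where
  "gp G = Max {card S | S. general_position_set G S}"

definition strong_product ::
  "'a pair_pre_digraph \<Rightarrow> 'b pair_pre_digraph \<Rightarrow> ('a \<times> 'b) pair_pre_digraph"
  (infixl \<open>\<boxtimes>\<close> 70) where
  "G \<boxtimes> H = \<lparr> pverts = pverts G \<times> pverts H,
     parcs = {((ux, uy), (vx, vy)) | ux uy vx vy.
        ux \<in> pverts G \<and> vx \<in> pverts G \<and> uy \<in> pverts H \<and> vy \<in> pverts H \<and>
        (ux = vx \<and> (uy, vy) \<in> parcs H \<or>
         uy = vy \<and> (ux, vx) \<in> parcs G \<or>
         (ux, vx) \<in> parcs G \<and> (uy, vy) \<in> parcs H)} \<rparr>"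

text \<open>The cycle on \<open>{0..<s}\<close>; a simple graph that is a cycle only for \<open>s \<ge> 3\<close>.\<close>

definition cycle_graph :: "nat \<Rightarrow> nat pair_pre_digraph" where
  "cycle_graph s = \<lparr> pverts = {0..<s},
     parcs = {(i, j). i < s \<and> j < s \<and> (j = (i + 1) mod s \<or> i = (j + 1) mod s)} \<rparr>"

lemma pair_graph_cycle_graph:
  assumes "s \<ge> 3"
  shows "pair_graph (cycle_graph s)"
proof
  show "finite (parcs (cycle_graph s))"
    by (rule finite_subset[of _ "{0..<s} \<times> {0..<s}"]) (auto simp: cycle_graph_def)
  show "symmetric (with_proj (cycle_graph s))"
    by (auto simp: symmetric_def sym_def cycle_graph_def)
  have "Suc i mod s \<noteq> i" if "i < s" for i
    using that assms by (cases "Suc i = s") auto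
  then show "fst e \<noteq> snd e" if "e \<in> parcs (cycle_graph s)" for e
    using that by (fastforce simp: cycle_graph_def)
qed (auto simp: cycle_graph_def)

lemma pair_graph_strong_product:
  assumes "pair_graph G" "pair_graph H"
  shows "pair_graph (G \<boxtimes> H)"
proof -
  interpret G: pair_graph G by fact
  interpret H: pair_graph H by fact
  show ?thesis
  proof
    show "finite (pverts (G \<boxtimes> H))"
      by (simp add: strong_product_def G.pair_finite_verts H.pair_finite_verts)
    show "finite (parcs (G \<boxtimes> H))"
      by (rule finite_subset[of _ "(pverts G \<times> pverts H) \<times> (pverts G \<times> pverts H)"])
        (auto simp: strong_product_def G.pair_finite_verts H.pair_finite_verts)
    show "symmetric (with_proj (G \<boxtimes> H))"
      using G.pair_sym_arcs H.pair_sym_arcs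
      unfolding symmetric_def sym_def with_proj_simps by (auto simp: strong_product_def)
  next
    fix e assume "e \<in> parcs (G \<boxtimes> H)"
    then show "fst e \<noteq> snd e"
      using G.pair_no_loops H.pair_no_loops by (fastforce simp: strong_product_def)
  qed (auto simp: strong_product_def)
qed

end

theory Submission
  imports Defs
begin

text \<open>
  An arc of \<open>h + 1\<close> consecutive vertices of the cycle is an isometric path, because no two of its
  vertices are more than \<open>h = \<lfloor>s/2\<rfloor>\<close> steps apart along it. Every vertex of the cycle lies on exactly
  \<open>h + 1\<close> of the \<open>s\<close> arcs. If a general position set \<open>S\<close> of the product has at most \<open>2 gp(H)\<close>
  vertices over each arc (\<open>card_over_arc_le\<close>), then counting pairs of a vertex of \<open>S\<close> and an arc
  below it gives \<open>(h + 1) |S| \<le> 2 s gp(H)\<close>, which is the claim.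

  The bound over one arc rests on the fact that distance in a strong product is the maximum of the
  distances of the coordinates (\<open>hop_dist_strong_product\<close>). Over an arc the metric is therefore
  \<open>max \<bar>i - j\<bar> (d\<^sub>H(x,y))\<close> on pairs of an integer position and a vertex of \<open>H\<close>. Order these pairs like
  events in space-time: \<open>(i,x)\<close> precedes \<open>(j,y)\<close> if \<open>j - i \<ge> d\<^sub>H(x,y)\<close>. Along a chain the distance is
  the difference of the positions, hence additive, so a set in general position contains no chain
  of three elements and splits into two antichains, its minimal elements and the others. On an
  antichain every distance is the distance of the second coordinates. So an antichain in general
  position projects injectively to a general position set of \<open>H\<close>, and has at most \<open>gp(H)\<close> elements
  (\<open>card_strip_general_position_le\<close>).
\<close>

section \<open>Distance as a number of lazy steps\<close>

text \<open>
  A step may also stay in place. Walks of length at most \<open>n\<close> then become \<open>n\<close>-th relational powers, and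
  the relation of a strong product becomes the componentwise product of the relations of its factors.
\<close>
definition lazy_adj :: "'a pair_pre_digraph \<Rightarrow> ('a \<times> 'a) set" where
  "lazy_adj G = parcs G \<union> Id_on (pverts G)"

definition hop_dist :: "'a pair_pre_digraph \<Rightarrow> 'a \<Rightarrow> 'a \<Rightarrow> nat" where
  "hop_dist G u v = (LEAST n. (u, v) \<in> lazy_adj G ^^ n)"

text \<open>
  Connectedness in the form in which it passes to products; it also makes the \<open>LEAST\<close> in
  \<open>hop_dist\<close> range over a nonempty set.
\<close>
definition all_reachable :: "'a pair_pre_digraph \<Rightarrow> bool" where
  "all_reachable G \<longleftrightarrow> (\<forall>u\<in>pverts G. \<forall>v\<in>pverts G. \<exists>n. (u, v) \<in> lazy_adj G ^^ n)"

lemma lazy_steps_in_verts: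
  assumes "pair_graph G" "(u, v) \<in> lazy_adj G ^^ n" "u \<in> pverts G"
  shows "v \<in> pverts G"
proof -
  interpret pair_graph G by fact
  show ?thesis
    using assms(2)
  proof (induction n arbitrary: v)
    case 0
    then show ?case using assms(3) by simp
  next
    case (Suc n)
    then show ?case
      by (auto simp: lazy_adj_def dest: in_arcsD2)
  qed
qed

lemma lazy_steps_mono:
  assumes "pair_graph G" "u \<in> pverts G" "(u, v) \<in> lazy_adj G ^^ m" "m \<le> n"
  shows "(u, v) \<in> lazy_adj G ^^ n"
  using assms(4,3)
proof (induction n rule: dec_induct)
  case (step n)
  then have "(v, v) \<in> lazy_adj G"
    using lazy_steps_in_verts[OF assms(1) _ assms(2)] by (auto simp: lazy_adj_def)
  with step show ?case by auto
qed

text \<open>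
  The interface to \<open>hop_dist\<close>: an equation between distances follows from an equivalence between
  the corresponding statements about lazy walks of arbitrary length.
\<close>
lemma hop_dist_le_iff:
  assumes "pair_graph G" "all_reachable G" "u \<in> pverts G" "v \<in> pverts G"
  shows "hop_dist G u v \<le> n \<longleftrightarrow> (u, v) \<in> lazy_adj G ^^ n"
proof
  obtain m where "(u, v) \<in> lazy_adj G ^^ m"
    using assms(2-4) by (auto simp: all_reachable_def)
  then have "(u, v) \<in> lazy_adj G ^^ hop_dist G u v"
    unfolding hop_dist_def by (rule LeastI)
  then show "(u, v) \<in> lazy_adj G ^^ n" if "hop_dist G u v \<le> n"
    using lazy_steps_mono[OF assms(1,3) _ that] by blast
qed (simp add: hop_dist_def Least_le)

lemma awalk_imp_lazy_steps:
  assumes "pair_graph G" "pre_digraph.awalk (with_proj G) u p v"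
  shows "(u, v) \<in> lazy_adj G ^^ length p"
proof -
  interpret pair_graph G by fact
  show ?thesis using assms(2)
  proof (induction p arbitrary: u)
    case (Cons e p)
    then have "(u, snd e) \<in> lazy_adj G" "(snd e, v) \<in> lazy_adj G ^^ length p"
      by (auto simp: awalk_Cons_iff lazy_adj_def)
    then show ?case by (simp only: list.size relpow_Suc_I2 One_nat_def add_Suc_right add_0_right)
  qed (simp add: awalk_Nil_iff)
qed

lemma lazy_steps_imp_awalk:
  assumes "pair_graph G" "(u, v) \<in> lazy_adj G ^^ n" "u \<in> pverts G"
  shows "\<exists>p. pre_digraph.awalk (with_proj G) u p v \<and> length p \<le> n"
proof -
  interpret pair_graph G by fact
  show ?thesis using assms(2,3)
  proof (induction n arbitrary: u)
    case 0
    then show ?case by (auto intro: exI[of _ "[]"] simp: awalk_Nil_iff)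
  next
    case (Suc n)
    obtain w where w: "(u, w) \<in> lazy_adj G" "(w, v) \<in> lazy_adj G ^^ n"
      using Suc.prems(1) by (blast dest: relpow_Suc_D2)
    show ?case
    proof (cases "(u, w) \<in> parcs G")
      case True
      with Suc.IH[OF w(2)] obtain p where "awalk w p v" "length p \<le> n"
        by (auto dest: in_arcsD2)
      with True show ?thesis
        by (intro exI[of _ "(u, w) # p"]) (simp add: awalk_Cons_iff)
    next
      case False
      with w(1) have "u = w" by (auto simp: lazy_adj_def)
      then show ?thesis using Suc.IH[OF w(2)] Suc.prems(2) by (auto intro: le_SucI)
    qed
  qed
qed

text \<open>
  Replaces extended real infima over walks by natural numbers, for which the arithmetic below is
  linear.
\<close>
lemma gdist_eq_hop_dist:
  assumes "pair_graph G" "all_reachable G" "u \<in> pverts G" "v \<in> pverts G"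
  shows "gdist G u v = ereal (real (hop_dist G u v))"
proof -
  interpret pair_graph G by fact
  have cost: "awalk_cost (\<lambda>_. 1) p = real (length p)" for p :: "('a \<times> 'a) list"
    by (induction p) auto
  note le_iff = hop_dist_le_iff[OF assms]
  obtain p where p: "awalk u p v" "length p \<le> hop_dist G u v"
    using lazy_steps_imp_awalk[OF assms(1) _ assms(3)] le_iff by blast
  show ?thesis
    unfolding gdist_def
  proof (rule antisym)
    have "\<mu> (\<lambda>_. 1) u v \<le> ereal (awalk_cost (\<lambda>_. 1) p)"
      by (rule min_cost_le_walk_cost[OF p(1)])
    also have "\<dots> \<le> ereal (real (hop_dist G u v))"
      using p(2) by (simp add: cost)
    finally show "\<mu> (\<lambda>_. 1) u v \<le> ereal (real (hop_dist G u v))" .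
    show "ereal (real (hop_dist G u v)) \<le> \<mu> (\<lambda>_. 1) u v"
      unfolding \<mu>_def
    proof (rule INF_greatest)
      fix q assume "q \<in> {q. awalk u q v}"
      then have "hop_dist G u v \<le> length q"
        using awalk_imp_lazy_steps[OF assms(1)] le_iff by blast
      then show "ereal (real (hop_dist G u v)) \<le> ereal (awalk_cost (\<lambda>_. 1) q)"
        by (simp add: cost)
    qed
  qed
qed

lemma all_reachable_if_connected:
  assumes "pair_graph G" "connected (with_proj G)"
  shows "all_reachable G"
proof -
  interpret pair_graph G by fact
  have "strongly_connected (with_proj G)"
    using symmetric_connected_imp_strongly_connected sym_arcs assms(2) by blast
  then have "\<exists>p. awalk u p v" if "u \<in> pverts G" "v \<in> pverts G" for u v
    using that by (simp add: strongly_connected_def reachable_awalk)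
  then show ?thesis
    unfolding all_reachable_def using awalk_imp_lazy_steps[OF assms(1)] by blast
qed

lemma hop_dist_eq_0_iff:
  assumes "pair_graph G" "all_reachable G" "u \<in> pverts G" "v \<in> pverts G"
  shows "hop_dist G u v = 0 \<longleftrightarrow> u = v"
  using hop_dist_le_iff[OF assms, of 0] by simp

lemma hop_dist_commute:
  assumes "pair_graph G" "all_reachable G" "u \<in> pverts G" "v \<in> pverts G"
  shows "hop_dist G u v = hop_dist G v u"
proof -
  interpret pair_graph G by fact
  have "sym (lazy_adj G)"
    using pair_sym_arcs by (auto simp: lazy_adj_def symmetric_def intro!: sym_Un sym_Id_on)
  then have "(b, a) \<in> lazy_adj G ^^ n" if "(a, b) \<in> lazy_adj G ^^ n" for a b n
    using that
  proof (induction n arbitrary: b)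
    case (Suc n)
    then obtain c where "(a, c) \<in> lazy_adj G ^^ n" "(c, b) \<in> lazy_adj G" by auto
    then show ?case using Suc.IH Suc.prems(1) by (blast intro: relpow_Suc_I2 dest: symD)
  qed simp
  then have "(u, v) \<in> lazy_adj G ^^ n \<longleftrightarrow> (v, u) \<in> lazy_adj G ^^ n" for n by blast
  then show ?thesis by (simp add: hop_dist_def)
qed

lemma hop_dist_triangle:
  assumes "pair_graph G" "all_reachable G" "u \<in> pverts G" "v \<in> pverts G" "w \<in> pverts G"
  shows "hop_dist G u w \<le> hop_dist G u v + hop_dist G v w"
proof -
  have "(u, v) \<in> lazy_adj G ^^ hop_dist G u v" "(v, w) \<in> lazy_adj G ^^ hop_dist G v w"
    using hop_dist_le_iff[OF assms(1-4), of "hop_dist G u v"]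
      hop_dist_le_iff[OF assms(1,2,4,5), of "hop_dist G v w"] by simp_all
  then show ?thesis
    unfolding hop_dist_le_iff[OF assms(1,2,3,5)] by (rule relpow_trans)
qed

lemma general_position_set_hop_dist:
  assumes "pair_graph G" "all_reachable G"
  shows "general_position_set G S \<longleftrightarrow> S \<subseteq> pverts G \<and>
     (\<forall>u\<in>S. \<forall>v\<in>S. \<forall>w\<in>S. u \<noteq> v \<longrightarrow> u \<noteq> w \<longrightarrow> v \<noteq> w \<longrightarrow>
        hop_dist G u v \<noteq> hop_dist G u w + hop_dist G w v)"
proof -
  have "gdist G u v = gdist G u w + gdist G w v \<longleftrightarrow>
      hop_dist G u v = hop_dist G u w + hop_dist G w v"
    if "S \<subseteq> pverts G" "u \<in> S" "v \<in> S" "w \<in> S" for u v w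
    using that by (simp add: subsetD gdist_eq_hop_dist[OF assms] flip: of_nat_add)
  then show ?thesis
    unfolding general_position_set_def by (metis (lifting))
qed

section \<open>The general position number\<close>

lemma finite_general_position_cards:
  assumes "pair_graph G"
  shows "finite {card S | S. general_position_set G S}"
proof -
  interpret pair_graph G by fact
  show ?thesis
    by (rule finite_surj[of "Pow (pverts G)" _ card]) (auto simp: general_position_set_def)
qed

lemma card_le_gp:
  assumes "pair_graph G" "general_position_set G S"
  shows "card S \<le> gp G"
  unfolding gp_def using assms by (intro Max_ge finite_general_position_cards) auto

lemma gp_attained:
  assumes "pair_graph G"
  obtains S where "general_position_set G S" "card S = gp G"
proof -
  have "general_position_set G {}" by (simp add: general_position_set_def)
  then have "gp G \<in> {card S | S. general_position_set G S}"
    unfolding gp_def using finite_general_position_cards[OF assms] by (intro Max_in) auto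
  then show thesis using that by auto
qed

section \<open>Distances in strong products and cycles\<close>

text \<open>
  A single lazy step in the product consists of independent lazy steps in the two factors: the three
  kinds of edges of a strong product and the stationary step are the four ways to move or stay in
  each coordinate. Iteration preserves this independence.
\<close>
lemma lazy_steps_strong_product:
  assumes "pair_graph G" "pair_graph H" "x \<in> pverts G" "y \<in> pverts H"
  shows "((x, y), (x', y')) \<in> lazy_adj (G \<boxtimes> H) ^^ n \<longleftrightarrow>
    (x, x') \<in> lazy_adj G ^^ n \<and> (y, y') \<in> lazy_adj H ^^ n"
proof (induction n arbitrary: x' y')
  case (Suc n)
  interpret G: pair_graph G by fact
  interpret H: pair_graph H by fact
  have adj: "((a, b), (a', b')) \<in> lazy_adj (G \<boxtimes> H) \<longleftrightarrow>
      (a, a') \<in> lazy_adj G \<and> (b, b') \<in> lazy_adj H" for a b a' b'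
    by (auto simp: lazy_adj_def strong_product_def dest: G.in_arcsD1 G.in_arcsD2 H.in_arcsD1 H.in_arcsD2)
  show ?case
    by (auto simp: relcomp_unfold Suc.IH adj)
qed auto

lemma pverts_strong_product: "pverts (G \<boxtimes> H) = pverts G \<times> pverts H"
  by (simp add: strong_product_def)

lemma all_reachable_strong_product:
  assumes "pair_graph G" "pair_graph H" "all_reachable G" "all_reachable H"
  shows "all_reachable (G \<boxtimes> H)"
proof -
  have "((x, y), (x', y')) \<in> lazy_adj (G \<boxtimes> H) ^^ max (hop_dist G x x') (hop_dist H y y')"
    if "x \<in> pverts G" "y \<in> pverts H" "x' \<in> pverts G" "y' \<in> pverts H" for x y x' y'
    using assms that by (simp add: lazy_steps_strong_product flip: hop_dist_le_iff)
  then show ?thesis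
    unfolding all_reachable_def pverts_strong_product by blast
qed

lemma hop_dist_strong_product:
  assumes "pair_graph G" "pair_graph H" "all_reachable G" "all_reachable H"
    and "x \<in> pverts G" "y \<in> pverts H" "x' \<in> pverts G" "y' \<in> pverts H"
  shows "hop_dist (G \<boxtimes> H) (x, y) (x', y') = max (hop_dist G x x') (hop_dist H y y')"
proof -
  have "hop_dist (G \<boxtimes> H) (x, y) (x', y') \<le> n \<longleftrightarrow>
      max (hop_dist G x x') (hop_dist H y y') \<le> n" for n
  proof -
    have "hop_dist (G \<boxtimes> H) (x, y) (x', y') \<le> n \<longleftrightarrow>
        ((x, y), (x', y')) \<in> lazy_adj (G \<boxtimes> H) ^^ n"
      using assms(5-8)
      by (intro hop_dist_le_iff pair_graph_strong_product all_reachable_strong_product assms(1-4))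
        (simp_all add: pverts_strong_product)
    then show ?thesis
      by (simp add: lazy_steps_strong_product[OF assms(1,2,5,6)]
        hop_dist_le_iff[OF assms(1,3,5,7)] hop_dist_le_iff[OF assms(2,4,6,8)])
  qed
  then show ?thesis
    by (metis order_antisym order_refl)
qed

text \<open>
  Lifting a walk to the universal cover \<open>\<int>\<close> of the cycle: \<open>k\<close> is the signed displacement of the lift.
\<close>
lemma lazy_steps_cycle:
  assumes "x < s"
  shows "(x, y) \<in> lazy_adj (cycle_graph s) ^^ n \<longleftrightarrow>
    y < s \<and> (\<exists>k. \<bar>k\<bar> \<le> int n \<and> int y = (int x + k) mod int s)"
proof (induction n arbitrary: y)
  case 0
  then show ?case using assms by auto
next
  case (Suc n)
  have adj: "(z, y) \<in> lazy_adj (cycle_graph s) \<longleftrightarrow>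
      z < s \<and> y < s \<and> (\<exists>j. \<bar>j\<bar> \<le> 1 \<and> int y = (int z + j) mod int s)" for z y
  proof (cases "z < s \<and> y < s")
    case True
    have *: "(\<exists>j::int. \<bar>j\<bar> \<le> 1 \<and> P j) \<longleftrightarrow> P 0 \<or> P 1 \<or> P (-1)" for P
    proof -
      have "\<bar>j\<bar> \<le> 1 \<longleftrightarrow> j = 0 \<or> j = 1 \<or> j = -1" for j :: int by auto
      then show ?thesis by auto
    qed
    have up: "y = (z + 1) mod s \<longleftrightarrow> int y = (int z + 1) mod int s" for y z
      using of_nat_eq_iff[of y "(z + 1) mod s", where ?'a = int]
      by (simp add: of_nat_mod add.commute)
    have down: "int y = (int z + - 1) mod int s \<longleftrightarrow> int z = (int y + 1) mod int s"
    proof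
      assume "int y = (int z + - 1) mod int s"
      then have "(int y + 1) mod int s = int z mod int s"
        by (simp add: mod_simps)
      with True show "int z = (int y + 1) mod int s" by simp
    next
      assume "int z = (int y + 1) mod int s"
      then have "(int z + - 1) mod int s = int y mod int s"
        by (simp add: mod_simps)
      with True show "int y = (int z + - 1) mod int s" by simp
    qed
    have "(z, y) \<in> lazy_adj (cycle_graph s) \<longleftrightarrow> z = y \<or> y = (z + 1) mod s \<or> z = (y + 1) mod s"
      using True by (auto simp: lazy_adj_def cycle_graph_def)
    then show ?thesis
      using True unfolding * down up by simp blast
  qed (auto simp: lazy_adj_def cycle_graph_def)
  have relcomp_iff: "(a, c) \<in> Q O R \<longleftrightarrow> (\<exists>b. (a, b) \<in> Q \<and> (b, c) \<in> R)" for a c Q R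
    by blast
  have "(x, y) \<in> lazy_adj (cycle_graph s) ^^ Suc n \<longleftrightarrow>
      (\<exists>z. (z < s \<and> (\<exists>k. \<bar>k\<bar> \<le> int n \<and> int z = (int x + k) mod int s)) \<and>
        y < s \<and> (\<exists>j. \<bar>j\<bar> \<le> 1 \<and> int y = (int z + j) mod int s))"
    unfolding relpow.simps relcomp_iff Suc.IH adj by blast
  also have "\<dots> \<longleftrightarrow> y < s \<and> (\<exists>k. \<bar>k\<bar> \<le> int (Suc n) \<and> int y = (int x + k) mod int s)"
    (is "?L \<longleftrightarrow> ?R")
  proof
    assume ?L
    then obtain z k j where "y < s" "\<bar>k\<bar> \<le> int n" "int z = (int x + k) mod int s"
      "\<bar>j\<bar> \<le> 1" "int y = (int z + j) mod int s" by blast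
    then show ?R
      by (intro conjI exI[of _ "k + j"]) (auto simp: mod_simps add.assoc)
  next
    assume ?R
    then obtain k where k: "y < s" "\<bar>k\<bar> \<le> int (Suc n)" "int y = (int x + k) mod int s"
      by blast
    \<comment> \<open>The last step of the walk goes in the direction of the displacement, or stays if \<open>k = 0\<close>.\<close>
    define z where "z = nat ((int x + (k - sgn k)) mod int s)"
    have z: "int z = (int x + (k - sgn k)) mod int s"
      using assms by (simp add: z_def)
    moreover have "z < s" using assms by (simp add: z_def nat_less_iff)
    moreover have "int y = (int z + sgn k) mod int s"
      using k(3) by (simp add: z mod_simps)
    moreover have "\<bar>k - sgn k\<bar> \<le> int n" "\<bar>sgn k\<bar> \<le> 1"
      using k(2) by (auto simp: sgn_if)
    ultimately show ?L using k(1) by blast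
  qed
  finally show ?case .
qed

lemma all_reachable_cycle: "all_reachable (cycle_graph s)"
  unfolding all_reachable_def
proof (intro ballI)
  fix x y assume "x \<in> pverts (cycle_graph s)" "y \<in> pverts (cycle_graph s)"
  then have "x < s" "y < s" by (auto simp: cycle_graph_def)
  then have "(x, y) \<in> lazy_adj (cycle_graph s) ^^ s"
    unfolding lazy_steps_cycle[OF \<open>x < s\<close>]
    by (intro conjI exI[of _ "int y - int x"]) auto
  then show "\<exists>n. (x, y) \<in> lazy_adj (cycle_graph s) ^^ n" ..
qed

text \<open>
  The arc starting at \<open>a\<close> is isometric: a displacement from position \<open>i\<close> to position \<open>j\<close> differs from
  \<open>j - i\<close> by a multiple of \<open>s\<close>, and a nonzero multiple makes it at least \<open>s - \<bar>i - j\<bar>\<close> long, which is no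
  shorter than \<open>\<bar>i - j\<bar>\<close> because \<open>\<bar>i - j\<bar> \<le> s/2\<close>.
\<close>
lemma hop_dist_cycle_arc:
  fixes a :: int
  assumes "s \<ge> 3" "x < s" "y < s"
    and i: "(int x - a) mod int s \<le> int (s div 2)" and j: "(int y - a) mod int s \<le> int (s div 2)"
  shows "int (hop_dist (cycle_graph s) x y) = \<bar>(int x - a) mod int s - (int y - a) mod int s\<bar>"
proof -
  define i j where "i = (int x - a) mod int s" and "j = (int y - a) mod int s"
  have ij: "0 \<le> i" "0 \<le> j" "2 * i \<le> int s" "2 * j \<le> int s"
    using assms by (simp_all add: i_def j_def)
  have "hop_dist (cycle_graph s) x y \<le> n \<longleftrightarrow> nat \<bar>i - j\<bar> \<le> n" for n
  proof -
    have "hop_dist (cycle_graph s) x y \<le> n \<longleftrightarrow> (x, y) \<in> lazy_adj (cycle_graph s) ^^ n"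
      using assms by (intro hop_dist_le_iff pair_graph_cycle_graph all_reachable_cycle)
        (auto simp: cycle_graph_def)
    also have "\<dots> \<longleftrightarrow> (\<exists>k. \<bar>k\<bar> \<le> int n \<and> int y = (int x + k) mod int s)"
      using assms by (simp add: lazy_steps_cycle)
    also have "\<dots> \<longleftrightarrow> \<bar>i - j\<bar> \<le> int n"
    proof
      assume "\<exists>k. \<bar>k\<bar> \<le> int n \<and> int y = (int x + k) mod int s"
      then obtain k where k: "\<bar>k\<bar> \<le> int n" "int y = (int x + k) mod int s" by blast
      have "(i + k) mod int s = j mod int s"
        by (simp add: i_def j_def k(2) mod_simps algebra_simps)
      then obtain m where m: "i + k - j = int s * m"
        by (auto simp: mod_eq_dvd_iff)
      show "\<bar>i - j\<bar> \<le> int n"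
      proof (cases "m = 0")
        case False
        then have "int s * 1 \<le> int s * \<bar>m\<bar>" by (intro mult_left_mono) auto
        then have "int s \<le> \<bar>i + k - j\<bar>" by (simp add: m abs_mult)
        with ij k(1) show ?thesis by linarith
      qed (use m k(1) in auto)
    next
      assume "\<bar>i - j\<bar> \<le> int n"
      moreover have "int y = (int x + (j - i)) mod int s"
      proof -
        have "(int x + (j - i)) mod int s = (int x + ((int y - a) - (int x - a))) mod int s"
          unfolding i_def j_def by (metis mod_add_right_eq mod_diff_eq)
        then show ?thesis using assms(3) by simp
      qed
      ultimately show "\<exists>k. \<bar>k\<bar> \<le> int n \<and> int y = (int x + k) mod int s"
        by (intro exI[of _ "j - i"]) auto
    qed
    finally show ?thesis by auto
  qed
  then have "hop_dist (cycle_graph s) x y = nat \<bar>i - j\<bar>"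
    by (metis order_antisym order_refl)
  then show ?thesis by (simp add: i_def j_def)
qed

section \<open>Sets over an isometric path\<close>

text \<open>
  Mirsky's theorem for height two: the elements without a predecessor in \<open>T\<close> form an antichain, and a
  comparable pair among the other elements would extend downwards to a chain of three.
\<close>
lemma card_le_two_antichains:
  assumes "finite T"
    and no_chain: "\<And>p q r. \<lbrakk>p \<in> T; q \<in> T; r \<in> T; lt p q; lt q r\<rbrakk> \<Longrightarrow> False"
    and antichain: "\<And>A. \<lbrakk>A \<subseteq> T; \<And>p q. \<lbrakk>p \<in> A; q \<in> A\<rbrakk> \<Longrightarrow> \<not> lt p q\<rbrakk> \<Longrightarrow> card A \<le> k"
  shows "card T \<le> 2 * k"
proof -
  define A where "A = {p \<in> T. \<forall>q\<in>T. \<not> lt q p}"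
  have "card A \<le> k" by (rule antichain) (auto simp: A_def)
  moreover have "card (T - A) \<le> k"
    by (rule antichain) (auto simp: A_def intro: no_chain)
  moreover have "card T = card A + card (T - A)"
    using assms(1) by (subst card_Diff_subset) (auto simp: A_def finite_subset card_mono)
  ultimately show ?thesis by simp
qed

text \<open>
  The strong product metric of \<open>H\<close> with the two-way infinite path on \<open>\<int>\<close>.
\<close>
definition strip_dist :: "'a pair_pre_digraph \<Rightarrow> int \<times> 'a \<Rightarrow> int \<times> 'a \<Rightarrow> int" where
  "strip_dist H p q = max \<bar>fst p - fst q\<bar> (int (hop_dist H (snd p) (snd q)))"

text \<open>
  Two points are comparable if their distance is realised by the integer coordinate. Incomparable
  points have their distance realised strictly by \<open>H\<close>, so antichains are copies of general
  position sets of \<open>H\<close>.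
\<close>
lemma card_strip_general_position_le:
  assumes "pair_graph H" "all_reachable H" "finite T" "snd ` T \<subseteq> pverts H"
    and gen: "\<And>u v w. \<lbrakk>u \<in> T; v \<in> T; w \<in> T; u \<noteq> v; u \<noteq> w; v \<noteq> w\<rbrakk> \<Longrightarrow>
      strip_dist H u v \<noteq> strip_dist H u w + strip_dist H w v"
  shows "card T \<le> 2 * gp H"
proof -
  define d where "d p q = int (hop_dist H (snd p) (snd q))" for p q :: "int \<times> 'a"
  have V: "snd p \<in> pverts H" if "p \<in> T" for p using assms(4) that by auto
  have d0: "d p q \<le> 0 \<longleftrightarrow> snd p = snd q" if "p \<in> T" "q \<in> T" for p q
    using hop_dist_eq_0_iff[OF assms(1,2) V V] that by (auto simp: d_def)
  have dsym: "d p q = d q p" if "p \<in> T" "q \<in> T" for p q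
    using hop_dist_commute[OF assms(1,2) V V] that by (auto simp: d_def)
  have tri: "d p r \<le> d p q + d q r" if "p \<in> T" "q \<in> T" "r \<in> T" for p q r
    using hop_dist_triangle[OF assms(1,2) V V V] that by (auto simp: d_def simp flip: of_nat_add)
  have sd: "strip_dist H p q = max \<bar>fst p - fst q\<bar> (d p q)" for p q
    by (simp add: strip_dist_def d_def)
  have d_nonneg: "0 \<le> d p q" for p q by (simp add: d_def)
  define lt where "lt p q \<longleftrightarrow> p \<noteq> q \<and> d p q \<le> fst q - fst p" for p q
  show ?thesis
  proof (rule card_le_two_antichains[where lt = lt])
    show "finite T" by fact
  next
    fix p q r assume T: "p \<in> T" "q \<in> T" "r \<in> T" and lt: "lt p q" "lt q r"
    \<comment> \<open>Antisymmetry; without it a chain of three could repeat an element.\<close>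
    have "p \<noteq> r"
    proof
      assume "p = r"
      then have "d p q \<le> 0" "fst p = fst q"
        using lt dsym[OF T(1,2)] d_nonneg[of p q] by (auto simp: lt_def)
      then show False using lt d0[OF T(1,2)] by (auto simp: lt_def prod_eq_iff)
    qed
    moreover have "strip_dist H p r = strip_dist H p q + strip_dist H q r"
      using lt tri[OF T] d_nonneg[of p q] d_nonneg[of q r] by (auto simp: sd lt_def)
    ultimately show False using gen[of p r q] T lt by (auto simp: lt_def)
  next
    fix A assume A: "A \<subseteq> T" and anti: "\<And>p q. \<lbrakk>p \<in> A; q \<in> A\<rbrakk> \<Longrightarrow> \<not> lt p q"
    have vertical: "\<bar>fst p - fst q\<bar> < d p q" if "p \<in> A" "q \<in> A" "p \<noteq> q" for p q
      using anti[of p q] anti[of q p] that dsym[OF subsetD[OF A] subsetD[OF A], of p q]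
      by (auto simp: lt_def)
    have inj: "inj_on snd A"
    proof (rule inj_onI, rule ccontr)
      fix p q assume "p \<in> A" "q \<in> A" "snd p = snd q" "p \<noteq> q"
      then show False using vertical[of p q] d0[OF subsetD[OF A] subsetD[OF A], of p q] by simp
    qed
    have "general_position_set H (snd ` A)"
      unfolding general_position_set_hop_dist[OF assms(1,2)]
    proof (intro conjI)
      show "snd ` A \<subseteq> pverts H" using V A by auto
      have "d u v \<noteq> d u w + d w v"
        if "u \<in> A" "v \<in> A" "w \<in> A" "snd u \<noteq> snd v" "snd u \<noteq> snd w" "snd v \<noteq> snd w" for u v w
      proof -
        have ne: "u \<noteq> v" "u \<noteq> w" "v \<noteq> w" using that(4-6) by blast+
        have sd_eq: "strip_dist H p q = d p q" if "p \<in> A" "q \<in> A" "p \<noteq> q" for p q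
          using vertical[OF that] by (simp add: sd)
        show ?thesis
          using gen[OF subsetD[OF A that(1)] subsetD[OF A that(2)] subsetD[OF A that(3)] ne]
          unfolding sd_eq[OF that(1,2) ne(1)] sd_eq[OF that(1,3) ne(2)]
            sd_eq[OF that(3,2) ne(3)[symmetric]] .
      qed
      then have "hop_dist H (snd u) (snd v) \<noteq> hop_dist H (snd u) (snd w) + hop_dist H (snd w) (snd v)"
        if "u \<in> A" "v \<in> A" "w \<in> A" "snd u \<noteq> snd v" "snd u \<noteq> snd w" "snd v \<noteq> snd w" for u v w
        using that by (simp add: d_def flip: of_nat_add)
      then show "\<forall>u\<in>snd ` A. \<forall>v\<in>snd ` A. \<forall>w\<in>snd ` A. u \<noteq> v \<longrightarrow> u \<noteq> w \<longrightarrow> v \<noteq> w \<longrightarrow>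
          hop_dist H u v \<noteq> hop_dist H u w + hop_dist H w v"
        by (simp only: ball_simps(9)) blast
    qed
    then have "card (snd ` A) \<le> gp H" by (rule card_le_gp[OF assms(1)])
    then show "card A \<le> gp H" by (simp add: card_image[OF inj])
  qed
qed

section \<open>Averaging over the arcs of the cycle\<close>

text \<open>
  For a fixed \<open>x\<close>, an arc is determined by the position of \<open>x\<close> on it, which ranges over \<open>0, \<dots>, h\<close>.
\<close>
lemma card_arcs_containing:
  fixes x :: int
  assumes "h < s"
  shows "card {a \<in> {0..<int s}. (x - a) mod int s \<le> int h} = h + 1"
proof -
  have s: "int s > 0" using assms by simp
  have "bij_betw (\<lambda>a. (x - a) mod int s) {a \<in> {0..<int s}. (x - a) mod int s \<le> int h} {0..int h}"
  proof (rule bij_betw_byWitness[where f' = "\<lambda>i. (x - i) mod int s"])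
    show "\<forall>a\<in>{a \<in> {0..<int s}. (x - a) mod int s \<le> int h}. (x - (x - a) mod int s) mod int s = a"
      by (auto simp: mod_simps)
    show "\<forall>i\<in>{0..int h}. (x - (x - i) mod int s) mod int s = i"
      using assms by (auto simp: mod_simps)
    then show "(\<lambda>i. (x - i) mod int s) ` {0..int h} \<subseteq> {a \<in> {0..<int s}. (x - a) mod int s \<le> int h}"
      using s by auto
  qed (use s in auto)
  then show ?thesis by (simp add: bij_betw_same_card)
qed

text \<open>
  Reading off positions along the arc starting at \<open>a\<close> is an isometric embedding of the part of the
  product over this arc into \<open>\<int> \<times> H\<close> with the metric \<open>strip_dist\<close>.
\<close>
lemma card_over_arc_le:
  fixes a :: int
  assumes H: "pair_graph H" "all_reachable H" and s: "s \<ge> 3"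
    and S: "general_position_set (cycle_graph s \<boxtimes> H) S"
  shows "card {p \<in> S. (int (fst p) - a) mod int s \<le> int (s div 2)} \<le> 2 * gp H"
proof -
  let ?P = "cycle_graph s \<boxtimes> H"
  define pos where "pos x = (int x - a) mod int s" for x :: nat
  define T where "T = {p \<in> S. pos (fst p) \<le> int (s div 2)}"
  define emb where "emb p = (pos (fst p), snd p)" for p :: "nat \<times> 'a"
  note C = pair_graph_cycle_graph[OF s] all_reachable_cycle[of s]
  note P = pair_graph_strong_product[OF C(1) H(1)] all_reachable_strong_product[OF C(1) H(1) C(2) H(2)]
  have SP: "S \<subseteq> pverts ?P"
    using S by (simp add: general_position_set_def)
  have gen: "hop_dist ?P p q \<noteq> hop_dist ?P p r + hop_dist ?P r q"
    if "p \<in> S" "q \<in> S" "r \<in> S" "p \<noteq> q" "p \<noteq> r" "q \<noteq> r" for p q r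
    using S that unfolding general_position_set_hop_dist[OF P] by blast
  have SV: "fst p < s" "snd p \<in> pverts H" if "p \<in> S" for p
    using SP that by (auto simp: strong_product_def cycle_graph_def)
  interpret P: pair_graph ?P by (rule P)
  have fin: "finite T"
    using finite_subset[OF SP P.pair_finite_verts] by (simp add: T_def)
  have dist: "strip_dist H (emb p) (emb q) = int (hop_dist ?P p q)" if "p \<in> T" "q \<in> T" for p q
  proof -
    have pq: "p \<in> S" "q \<in> S" "pos (fst p) \<le> int (s div 2)" "pos (fst q) \<le> int (s div 2)"
      using that by (auto simp: T_def)
    have "int (hop_dist (cycle_graph s) (fst p) (fst q)) = \<bar>pos (fst p) - pos (fst q)\<bar>"
      using hop_dist_cycle_arc[OF s SV(1)[OF pq(1)] SV(1)[OF pq(2)], of a] pq(3,4)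
      by (simp add: pos_def)
    moreover have "hop_dist ?P p q =
        max (hop_dist (cycle_graph s) (fst p) (fst q)) (hop_dist H (snd p) (snd q))"
      using hop_dist_strong_product[OF C(1) H(1) C(2) H(2), of "fst p" "snd p" "fst q" "snd q"]
        SV pq(1,2) by (simp add: cycle_graph_def)
    ultimately show ?thesis
      by (simp add: strip_dist_def emb_def)
  qed
  have inj: "inj_on emb T"
  proof (rule inj_onI)
    fix p q assume pq: "p \<in> T" "q \<in> T" "emb p = emb q"
    have V: "p \<in> pverts ?P" "q \<in> pverts ?P" using pq(1,2) SP by (auto simp: T_def)
    have "int (hop_dist ?P p q) = int (hop_dist ?P p p)"
      using dist[OF pq(1,2)] dist[OF pq(1,1)] pq(3) by simp
    then show "p = q"
      using hop_dist_eq_0_iff[OF P V] hop_dist_eq_0_iff[OF P V(1,1)] by simp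
  qed
  have "card (emb ` T) \<le> 2 * gp H"
  proof (rule card_strip_general_position_le[OF H])
    show "finite (emb ` T)" using fin by simp
    show "snd ` emb ` T \<subseteq> pverts H" using SV by (auto simp: emb_def T_def)
    fix u v w assume "u \<in> emb ` T" "v \<in> emb ` T" "w \<in> emb ` T" "u \<noteq> v" "u \<noteq> w" "v \<noteq> w"
    then obtain p q r where pqr: "p \<in> T" "q \<in> T" "r \<in> T" "u = emb p" "v = emb q" "w = emb r"
      by (elim imageE) blast
    have "p \<noteq> q" "p \<noteq> r" "q \<noteq> r"
      using \<open>u \<noteq> v\<close> \<open>u \<noteq> w\<close> \<open>v \<noteq> w\<close> pqr(4-6) by blast+
    then have "hop_dist ?P p q \<noteq> hop_dist ?P p r + hop_dist ?P r q"
      using gen pqr(1-3) by (simp add: T_def)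
    then show "strip_dist H u v \<noteq> strip_dist H u w + strip_dist H w v"
      using pqr(1-3) by (simp add: pqr(4-6) dist flip: of_nat_add)
  qed
  then have "card T \<le> 2 * gp H" by (simp add: card_image[OF inj])
  then show ?thesis by (simp add: T_def pos_def)
qed

theorem theorem3p1:
  fixes H :: "'a pair_pre_digraph" and s h :: nat
  assumes "pair_graph H"
    and "connected (with_proj H)"
    and "s \<ge> 3"
    and "h = s div 2"
  shows "gp (cycle_graph s \<boxtimes> H) \<le> (2 * s * gp H) div (h + 1)"
proof -
  let ?P = "cycle_graph s \<boxtimes> H"
  interpret P: pair_graph ?P
    by (rule pair_graph_strong_product[OF pair_graph_cycle_graph[OF assms(3)] assms(1)])
  obtain S where S: "general_position_set ?P S" "card S = gp ?P"
    using gp_attained[OF P.pair_graph_axioms] .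
  have "finite S"
    using S(1) by (auto simp: general_position_set_def intro: finite_subset[OF _ P.pair_finite_verts])
  have "(h + 1) * card S = (\<Sum>a\<in>{0..<int s}. card {p \<in> S. (int (fst p) - a) mod int s \<le> int h})"
    using assms(3,4) \<open>finite S\<close>
    by (intro sum_multicount[symmetric] ballI card_arcs_containing) simp_all
  also have "\<dots> \<le> (\<Sum>a\<in>{0..<int s}. 2 * gp H)"
    using card_over_arc_le[OF assms(1) all_reachable_if_connected[OF assms(1,2)] assms(3) S(1)]
    by (intro sum_mono) (simp add: assms(4))
  also have "\<dots> = 2 * s * gp H" by simp
  finally show ?thesis
    by (simp add: S(2) less_eq_div_iff_mult_less_eq mult.commute)
qed

end
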